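(* Let $G$ be a graph and let $G^*=G\cup K_1$ be the graph obtained from $G$ by adding an isolated vertex. Then $G$ is a global amoeba if and only if $\operatorname{Fer}(G^* )$ acts transitively on the set of labels of $G^*$.
   Context: All graphs are finite and simple. A labeled graph $G$ comes with a bijection $\lambda:V(G)\to X$ onto a label set $X$; write $v_x=\lambda^{-1}(x)$ and $L_G=\{ij: v_iv_j\in E(G)\}$ (unordered pairs). For $\sigma\in\operatorname{Sym}(X)$, $G_\sigma$ is the graph on $V(G)$ with edge set $\{v_iv_j:\sigma(i)\sigma(j)\in L_G\}$. $\operatorname{Aut}(G)$ is identified with $\{\sigma\in\operatorname{Sym}(X): G_\sigma=G\}$. An edge-replacement $rs\to kl$ removes an edge $v_rv_s\in E(G)$ and adds $v_kv_l\in E(\overline G)\cup\{v_rv_s\}$; it is feasible if $G-v_rv_s+v_kv_l\cong G$. $R_G$ is the set of feasible edge-replacements $rs\to kl$ with $rs\ne kl$ together with the neutral replacement $\emptyset\to\emptyset$ (nothing changes). $\operatorname{Fer}_G(rs\to kl)=\{\sigma\in\operatorname{Sym}(X): G_\sigma=G-v_rv_s+v_kv_l\}$ and $\operatorname{Fer}_G(\emptyset\to\emptyset)=\operatorname{Aut}(G)$. $\mathcal{E}_G$ is the union of the sets $\operatorname{Fer}_G(e\to e')$ over all $e\to e'\in R_G$, and $\operatorname{Fer}(G)=\langle\mathcal{E}_G\rangle\le\operatorname{Sym}(X)$. $G$ is a local amoeba if $\operatorname{Fer}(G)=\operatorname{Sym}(X)$. $G$ is a global amoeba if $G\cup tK_1$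 is a local amoeba for some integer $t\ge1$ (by a known result, equivalently if $G\cup K_1$ is a local amoeba). *)

theory Defs
  imports "HOL-Algebra.Algebra"
begin

record 'v ugraph =
  verts :: "'v set"
  edges :: "'v set set"

definition pairs :: "'a set \<Rightarrow> 'a set set" where
  "pairs A = {{a, b} | a b. a \<in> A \<and> b \<in> A \<and> a \<noteq> b}"

definition simple_graph :: "('v, 'z) ugraph_scheme \<Rightarrow> bool" where
  "simple_graph G \<longleftrightarrow> finite (verts G) \<and> edges G \<subseteq> pairs (verts G)"

definition isomorphic :: "('v, 'z) ugraph_scheme \<Rightarrow> ('w, 'y) ugraph_scheme \<Rightarrow> bool" where
  "isomorphic G H \<longleftrightarrow>
     (\<exists>f. bij_betw f (verts G) (verts H) \<and>
        (\<forall>u\<in>verts G. \<forall>v\<in>verts G. {u, v} \<in> edges G \<longleftrightarrow> {f u, f v} \<in> edges H))"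

definition add_isolated :: "('v, 'z) ugraph_scheme \<Rightarrow> nat \<Rightarrow> ('v + nat) ugraph" where
  "add_isolated G t = \<lparr>verts = verts G <+> {..<t}, edges = (`) Inl ` edges G\<rparr>"

record ('v, 'x) lgraph = "'v ugraph" +
  labels :: "'x set"
  label :: "'v \<Rightarrow> 'x"

definition underlying :: "('v, 'x) lgraph \<Rightarrow> 'v ugraph" where
  "underlying G = ugraph.truncate G"

definition labeled_graph :: "('v, 'x) lgraph \<Rightarrow> bool" where
  "labeled_graph G \<longleftrightarrow> simple_graph G \<and> bij_betw (label G) (verts G) (labels G)"

definition vertex :: "('v, 'x) lgraph \<Rightarrow> 'x \<Rightarrow> 'v" where
  "vertex G = inv_into (verts G) (label G)"

definition label_edges :: "('v, 'x) lgraph \<Rightarrow> 'x set set" where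
  "label_edges G =
     {{i, j} | i j. i \<in> labels G \<and> j \<in> labels G \<and> {vertex G i, vertex G j} \<in> edges G}"

definition permute :: "('v, 'x) lgraph \<Rightarrow> ('x \<Rightarrow> 'x) \<Rightarrow> ('v, 'x) lgraph" where
  "permute G \<sigma> = G\<lparr>edges :=
     {{vertex G i, vertex G j} | i j.
        i \<in> labels G \<and> j \<in> labels G \<and> {\<sigma> i, \<sigma> j} \<in> label_edges G}\<rparr>"

definition Aut :: "('v, 'x) lgraph \<Rightarrow> ('x \<Rightarrow> 'x) set" where
  "Aut G = {\<sigma> \<in> carrier (BijGroup (labels G)). permute G \<sigma> = G}"

text \<open>An unordered pair of labels \<open>{r, s}\<close> stands for the vertex pair
  \<open>vertex G ` {r, s}\<close>; \<open>Replace e e'\<close> removes \<open>e\<close> and adds \<open>e'\<close>.\<close>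

datatype 'x replacement = Neutral | Replace "'x set" "'x set"

definition replace_edge :: "('v, 'x) lgraph \<Rightarrow> 'x set \<Rightarrow> 'x set \<Rightarrow> ('v, 'x) lgraph" where
  "replace_edge G e e' =
     G\<lparr>edges := insert (vertex G ` e') (edges G - {vertex G ` e})\<rparr>"

definition edge_replacement :: "('v, 'x) lgraph \<Rightarrow> 'x set \<Rightarrow> 'x set \<Rightarrow> bool" where
  "edge_replacement G e e' \<longleftrightarrow>
     e \<in> pairs (labels G) \<and> e' \<in> pairs (labels G) \<and>
     vertex G ` e \<in> edges G \<and>
     vertex G ` e' \<in> (pairs (verts G) - edges G) \<union> {vertex G ` e}"

definition feasible :: "('v, 'x) lgraph \<Rightarrow> 'x set \<Rightarrow> 'x set \<Rightarrow> bool" where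
  "feasible G e e' \<longleftrightarrow> edge_replacement G e e' \<and> isomorphic (replace_edge G e e') G"

definition feasible_replacements :: "('v, 'x) lgraph \<Rightarrow> 'x replacement set" where
  "feasible_replacements G = insert Neutral {Replace e e' | e e'. feasible G e e' \<and> e \<noteq> e'}"

fun Fer_replacement :: "('v, 'x) lgraph \<Rightarrow> 'x replacement \<Rightarrow> ('x \<Rightarrow> 'x) set" where
  "Fer_replacement G Neutral = Aut G"
| "Fer_replacement G (Replace e e') =
     {\<sigma> \<in> carrier (BijGroup (labels G)). permute G \<sigma> = replace_edge G e e'}"

definition Fer_generators :: "('v, 'x) lgraph \<Rightarrow> ('x \<Rightarrow> 'x) set" where
  "Fer_generators G = (\<Union>\<rho>\<in>feasible_replacements G. Fer_replacement G \<rho>)"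

definition Fer :: "('v, 'x) lgraph \<Rightarrow> ('x \<Rightarrow> 'x) set" where
  "Fer G = generate (BijGroup (labels G)) (Fer_generators G)"

definition local_amoeba :: "('v, 'x) lgraph \<Rightarrow> bool" where
  "local_amoeba G \<longleftrightarrow> Fer G = carrier (BijGroup (labels G))"

text \<open>Relabeling a graph conjugates \<open>Fer\<close> by the bijection between the label sets, so being a local
  amoeba does not depend on the labeling; every finite graph has a labeling by natural numbers.\<close>

definition global_amoeba :: "'v ugraph \<Rightarrow> bool" where
  "global_amoeba G \<longleftrightarrow>
     (\<exists>t\<ge>1. \<exists>H :: ('v + nat, nat) lgraph.
        labeled_graph H \<and> underlying H = add_isolated G t \<and> local_amoeba H)"

definition Fer_group :: "('v, 'x) lgraph \<Rightarrow> ('x \<Rightarrow> 'x) monoid" where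
  "Fer_group G = (BijGroup (labels G))\<lparr>carrier := Fer G\<rparr>"

end

theory Submission
  imports Defs
begin

text \<open>The generators of \<open>Fer(G)\<close> are the permutations mapping all edges but at most one to edges.
  If \<open>Fer(G\<^sup>*)\<close> is transitive, conjugating the swap of the two isolated vertices of \<open>G \<union> 2K\<^sub>1\<close> by it
  gives all transpositions involving the second one, so \<open>G \<union> 2K\<^sub>1\<close> is a local amoeba. Conversely,
  vertices of \<open>G\<^sup>*\<close> of degree at most 1 are swapped with the isolated vertex by a generator; a vertex
  outside its orbit thus has degree at least 2, and a generator for \<open>G \<union> tK\<^sub>1\<close> moves it like some
  generator for \<open>G\<^sup>*\<close> does. So the complement of the orbit is invariant under
  \<open>Fer(G \<union> tK\<^sub>1)\<close>, and it is empty if this group is symmetric.\<close>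

section \<open>Subgroups of the group of bijections\<close>

lemma carrier_BijGroup: "carrier (BijGroup A) = Bij A"
  by (simp add: BijGroup_def)

lemma mult_BijGroup:
  "\<sigma> \<in> Bij A \<Longrightarrow> \<tau> \<in> Bij A \<Longrightarrow> \<sigma> \<otimes>\<^bsub>BijGroup A\<^esub> \<tau> = compose A \<sigma> \<tau>"
  by (simp add: BijGroup_def)

lemma one_BijGroup: "\<one>\<^bsub>BijGroup A\<^esub> = (\<lambda>x\<in>A. x)"
  by (simp add: BijGroup_def)

lemma Bij_bij_betw: "\<sigma> \<in> Bij A \<Longrightarrow> bij_betw \<sigma> A A"
  by (simp add: Bij_def)

lemma restrict_bij_betw_Bij: "bij_betw f A A \<Longrightarrow> restrict f A \<in> Bij A"
  by (simp add: Bij_def)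

lemma transpose_Bij:
  "a \<in> A \<Longrightarrow> b \<in> A \<Longrightarrow> restrict (transpose a b) A \<in> Bij A"
  by (intro restrict_bij_betw_Bij permutes_imp_bij permutes_swap_id)

text \<open>A generator is injective, so it maps the finite set \<open>D\<close> onto itself once it
  maps \<open>D\<close> into itself. Inverses of generators therefore preserve \<open>D\<close> as
  well, and products inherit the property.\<close>

lemma generate_image_subset:
  assumes "\<sigma> \<in> generate (BijGroup A) S" "S \<subseteq> Bij A" "finite D" "D \<subseteq> A"
    and inv: "\<And>\<sigma>. \<sigma> \<in> S \<Longrightarrow> \<sigma> ` D \<subseteq> D"
  shows "\<sigma> ` D \<subseteq> D"
  using assms(1)
proof induction
  case one
  show ?case using \<open>D \<subseteq> A\<close> by (auto simp: one_BijGroup)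
next
  case (incl h)
  then show ?case by (rule inv)
next
  case (inv h)
  have h: "h \<in> Bij A" and inj: "inj_on h A"
    using inv \<open>S \<subseteq> Bij A\<close> Bij_bij_betw bij_betw_imp_inj_on by blast+
  have "h ` D = D"
    using assms(5)[OF inv] \<open>finite D\<close> inj \<open>D \<subseteq> A\<close>
    by (meson endo_inj_surj inj_on_subset)
  then have "inv_into A h ` D = D"
    using inv_into_image_cancel[OF inj \<open>D \<subseteq> A\<close>] by simp
  then show ?case
    using \<open>D \<subseteq> A\<close> by (auto simp: inv_BijGroup[OF h])
next
  case (eng h1 h2)
  have "generate (BijGroup A) S \<subseteq> Bij A"
    using group.generate_incl[OF group_BijGroup] \<open>S \<subseteq> Bij A\<close>
    by (metis carrier_BijGroup)
  then have "h1 \<otimes>\<^bsub>BijGroup A\<^esub> h2 = compose A h1 h2"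
    using eng.hyps by (intro mult_BijGroup) auto
  then have "(h1 \<otimes>\<^bsub>BijGroup A\<^esub> h2) ` D = h1 ` h2 ` D"
    using \<open>D \<subseteq> A\<close> by (force simp: compose_def image_image intro: image_cong)
  then show ?case
    using eng.IH by blast
qed

text \<open>Conjugating the transposition (a b) by \<open>\<sigma>\<close> gives the transposition
  of the images of a and b.\<close>

lemma subgroup_conj_transpose:
  assumes K: "subgroup K (BijGroup A)" and \<sigma>: "\<sigma> \<in> K"
    and t: "restrict (transpose a b) A \<in> K" and ab: "a \<in> A" "b \<in> A"
  shows "restrict (transpose (\<sigma> a) (\<sigma> b)) A \<in> K"
proof -
  have KA: "K \<subseteq> Bij A" using subgroup.subset[OF K] by (simp add: carrier_BijGroup)
  then have bij: "bij_betw \<sigma> A A" and \<sigma>A: "\<sigma> \<in> Bij A" using \<sigma> Bij_bij_betw by auto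
  then have inj: "inj_on \<sigma> A" and im: "\<sigma> ` A = A" by (auto simp: bij_betw_def)
  let ?c = "\<sigma> \<otimes>\<^bsub>BijGroup A\<^esub> (restrict (transpose a b) A \<otimes>\<^bsub>BijGroup A\<^esub> inv\<^bsub>BijGroup A\<^esub> \<sigma>)"
  have inv: "inv\<^bsub>BijGroup A\<^esub> \<sigma> \<in> K" using K \<sigma> by (rule subgroup.m_inv_closed)
  have c: "?c \<in> K"
    by (intro subgroup.m_closed[OF K] \<sigma> t inv)
  have "?c = restrict (transpose (\<sigma> a) (\<sigma> b)) A"
  proof (rule extensionalityI)
    show "?c \<in> extensional A" using c KA by (auto simp: Bij_def)
    show "restrict (transpose (\<sigma> a) (\<sigma> b)) A \<in> extensional A" by simp
    fix x assume "x \<in> A"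
    \<comment> \<open>Every point is written as a value of \<open>\<sigma>\<close>, on which the
      inverse in the conjugate cancels.\<close>
    then obtain y where y: "y \<in> A" "x = \<sigma> y" using im by blast
    have m: "transpose a b y \<in> A" using y ab by (auto simp: transpose_def)
    have e: "?c = compose A \<sigma> (compose A (restrict (transpose a b) A) (inv\<^bsub>BijGroup A\<^esub> \<sigma>))"
      using KA inv t \<sigma>A by (simp add: mult_BijGroup subset_iff compose_Bij)
    have "(inv\<^bsub>BijGroup A\<^esub> \<sigma>) x = y"
      using y \<open>x \<in> A\<close> inj by (simp add: inv_BijGroup[OF \<sigma>A])
    then have "?c x = \<sigma> (transpose a b y)"
      unfolding e using y \<open>x \<in> A\<close> by (simp add: compose_def)
    also have "\<dots> = transpose (\<sigma> a) (\<sigma> b) (\<sigma> y)"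
      using inj y ab by (auto simp: transpose_def inj_on_eq_iff)
    finally show "?c x = restrict (transpose (\<sigma> a) (\<sigma> b)) A x"
      using y \<open>x \<in> A\<close> by simp
  qed
  then show ?thesis using c by simp
qed

text \<open>For distinct a, b, c, conjugating (a c) by (b c) gives (a b), so \<open>K\<close>
  contains all transpositions, and these generate the permutations of a finite set.\<close>

lemma subgroup_star_transpositions:
  assumes K: "subgroup K (BijGroup A)" and "finite A" "c \<in> A"
    and star: "\<And>a. a \<in> A \<Longrightarrow> a \<noteq> c \<Longrightarrow> restrict (transpose a c) A \<in> K"
  shows "K = Bij A"
proof
  show KA: "K \<subseteq> Bij A" using subgroup.subset[OF K] by (simp add: carrier_BijGroup)
  have one: "restrict id A \<in> K"
    using subgroup.one_closed[OF K] by (simp add: one_BijGroup id_def)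
  have transp: "restrict (transpose a b) A \<in> K" if "a \<in> A" "b \<in> A" for a b
  proof (cases "a = b \<or> a = c \<or> b = c")
    case True
    then show ?thesis
      using that star one by (metis transpose_commute transpose_same)
  next
    case False
    then show ?thesis
      using subgroup_conj_transpose[OF K star[of b] star[of a]] that \<open>c \<in> A\<close>
      by (simp add: transpose_def)
  qed
  show "Bij A \<subseteq> K"
  proof
    fix \<sigma> assume \<sigma>: "\<sigma> \<in> Bij A"
    \<comment> \<open>Elements of \<open>Bij A\<close> are \<open>undefined\<close> outside
      \<open>A\<close>, whereas \<open>permutes\<close> asks for the identity there;
      \<open>p\<close> is \<open>\<sigma>\<close> with the other default, so that induction over
      transpositions applies.\<close>
    define p where "p x = (if x \<in> A then \<sigma> x else x)" for x
    have "bij_betw p A A"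
      using Bij_bij_betw[OF \<sigma>] by (simp add: p_def cong: bij_betw_cong)
    then have "p permutes A" by (rule bij_imp_permutes) (simp add: p_def)
    then have "restrict p A \<in> K" using \<open>finite A\<close>
    proof (induction rule: permutes_induct)
      case id
      show ?case by (rule one)
    next
      case (swap a b p)
      have t: "restrict (transpose a b) A \<in> K"
        by (intro transp swap)
      have "restrict (transpose a b) A \<otimes>\<^bsub>BijGroup A\<^esub> restrict p A \<in> K"
        using subgroup.m_closed[OF K] t swap by blast
      moreover have "restrict (transpose a b) A \<otimes>\<^bsub>BijGroup A\<^esub> restrict p A
          = restrict (transpose a b \<circ> p) A"
        using KA t swap.IH swap.hyps permutes_in_image[of p A]
        by (subst mult_BijGroup) (auto simp: compose_def fun_eq_iff subset_iff restrict_def)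
      ultimately show ?case by metis
    qed
    moreover have "restrict p A = \<sigma>"
      using \<sigma> by (auto simp: p_def Bij_def extensional_def)
    ultimately show "\<sigma> \<in> K" by simp
  qed
qed

text \<open>The inclusion of \<open>K\<close> is a homomorphism into the group of bijections, so
  evaluation is always a group action and only the single-orbit condition remains.\<close>

lemma transitive_action_subgroup_BijGroup:
  assumes K: "subgroup K (BijGroup A)"
  shows "transitive_action ((BijGroup A)\<lparr>carrier := K\<rparr>) A (\<lambda>\<sigma>. \<sigma>) \<longleftrightarrow>
    (\<forall>x\<in>A. \<forall>y\<in>A. \<exists>\<sigma>\<in>K. \<sigma> x = y)"
  using group.canonical_inj_is_hom[OF group_BijGroup K]
  by (auto simp: transitive_action_def transitive_action_axioms_def group_action_def id_def)

text \<open>The complements of \<open>K\<close> and of its image have equal cardinality, so any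
  bijection between them completes \<open>f\<close>.\<close>

lemma inj_on_extend_Bij:
  assumes "finite A" "K \<subseteq> A" "inj_on f K" "f ` K \<subseteq> A"
  obtains \<tau> where "\<tau> \<in> Bij A" "\<And>x. x \<in> K \<Longrightarrow> \<tau> x = f x"
proof -
  have "card (A - K) = card (A - f ` K)"
    using assms by (simp add: card_Diff_subset finite_subset card_image)
  then obtain h where h: "bij_betw h (A - K) (A - f ` K)"
    using \<open>finite A\<close> by (metis finite_Diff finite_same_card_bij)
  have "bij_betw (\<lambda>x. if x \<in> K then f x else h x) (K \<union> (A - K)) (f ` K \<union> (A - f ` K))"
    using h \<open>inj_on f K\<close> by (intro bij_betw_disjoint_Un) (auto simp: bij_betw_def)
  moreover have "K \<union> (A - K) = A" "f ` K \<union> (A - f ` K) = A" using assms by auto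
  ultimately have "restrict (\<lambda>x. if x \<in> K then f x else h x) A \<in> Bij A"
    by (simp add: restrict_bij_betw_Bij)
  then show thesis
    by (rule that) (use \<open>K \<subseteq> A\<close> in auto)
qed

section \<open>Almost automorphisms\<close>

text \<open>A bijection \<open>\<sigma>\<close> of the labels lies in \<open>Fer\<^sub>G(e \<rightarrow> e')\<close> for a suitable \<open>e \<rightarrow> e'\<close> iff it maps all
  edges but at most one to edges, the exceptional edge being \<open>e\<close>.\<close>

definition almost_aut :: "'x set set \<Rightarrow> 'x set \<Rightarrow> ('x \<Rightarrow> 'x) set" where
  "almost_aut E A = {\<sigma> \<in> Bij A. \<exists>f. \<forall>e\<in>E - {f}. \<sigma> ` e \<in> E}"

lemma almost_autI:
  "\<sigma> \<in> Bij A \<Longrightarrow> (\<And>e. e \<in> E \<Longrightarrow> e \<noteq> f \<Longrightarrow> \<sigma> ` e \<in> E) \<Longrightarrow> \<sigma> \<in> almost_aut E A"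
  by (auto simp: almost_aut_def)

lemma almost_autE:
  assumes "\<sigma> \<in> almost_aut E A"
  obtains f where "\<sigma> \<in> Bij A" "\<And>e. e \<in> E \<Longrightarrow> e \<noteq> f \<Longrightarrow> \<sigma> ` e \<in> E"
  using assms unfolding almost_aut_def by blast

lemma almost_aut_subset_Bij: "almost_aut E A \<subseteq> Bij A"
  by (auto simp: almost_aut_def)

lemma subgroup_generate_almost_aut:
  "subgroup (generate (BijGroup A) (almost_aut E A)) (BijGroup A)"
  by (intro group.generate_is_subgroup group_BijGroup)
    (simp add: carrier_BijGroup almost_aut_subset_Bij)

section \<open>Edge sets on vertices and edge sets on labels\<close>

lemma finite_pairs: "finite A \<Longrightarrow> finite (pairs A)"
  by (rule finite_subset[of _ "Pow A"]) (auto simp: pairs_def)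

text \<open>This is the edge set of \<open>permute G \<sigma>\<close> expressed in labels, which
  allows the vertices to be left aside in the arguments about \<open>Fer\<close>.\<close>

definition pulled_edges :: "('v, 'x) lgraph \<Rightarrow> ('x \<Rightarrow> 'x) \<Rightarrow> 'x set set" where
  "pulled_edges G \<sigma> = {p \<in> pairs (labels G). \<sigma> ` p \<in> label_edges G}"

context
  fixes G :: "('v, 'x) lgraph"
  assumes lg: "labeled_graph G"
begin

lemma finite_labels: "finite (labels G)"
  using lg by (auto simp: labeled_graph_def simple_graph_def dest: bij_betw_finite)

lemma bij_betw_vertex: "bij_betw (vertex G) (labels G) (verts G)"
  using lg by (simp add: labeled_graph_def vertex_def bij_betw_inv_into)

lemma vertex_label: "v \<in> verts G \<Longrightarrow> vertex G (label G v) = v"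
  using lg by (simp add: labeled_graph_def vertex_def bij_betw_def)

lemma label_vertex: "i \<in> labels G \<Longrightarrow> label G (vertex G i) = i"
  using lg unfolding labeled_graph_def vertex_def by (metis bij_betw_inv_into_right)

lemma label_in_labels: "v \<in> verts G \<Longrightarrow> label G v \<in> labels G"
  using lg by (auto simp: labeled_graph_def bij_betw_def)

lemma vertex_in_verts: "i \<in> labels G \<Longrightarrow> vertex G i \<in> verts G"
  using bij_betw_vertex by (auto simp: bij_betw_def)

lemma edges_subset_pairs: "edges G \<subseteq> pairs (verts G)"
  using lg by (simp add: labeled_graph_def simple_graph_def)

text \<open>The comprehension defining \<open>label_edges\<close> admits i = j, but a simple graph
  has no loops, so only genuine pairs survive.\<close>

lemma label_edges_eq: "label_edges G = {p \<in> pairs (labels G). vertex G ` p \<in> edges G}"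
proof -
  have "i \<noteq> j" if "{vertex G i, vertex G j} \<in> edges G" for i j
    using that edges_subset_pairs by (auto simp: pairs_def doubleton_eq_iff)
  then show ?thesis by (fastforce simp: label_edges_def pairs_def)
qed

lemma label_edges_subset_pairs: "label_edges G \<subseteq> pairs (labels G)"
  by (auto simp: label_edges_eq)

lemma label_edges_image: "label_edges G = (`) (label G) ` edges G"
proof (rule equalityI; rule subsetI)
  fix p assume "p \<in> label_edges G"
  then have p: "p \<in> pairs (labels G)" "vertex G ` p \<in> edges G" by (auto simp: label_edges_eq)
  then have "label G ` vertex G ` p = p" by (auto simp: pairs_def label_vertex)
  then show "p \<in> (`) (label G) ` edges G" using p by (metis image_eqI)
next
  fix p assume "p \<in> (`) (label G) ` edges G"
  then obtain e where e: "e \<in> edges G" "p = label G ` e" by blast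
  then obtain u v where uv: "e = {u, v}" "u \<in> verts G" "v \<in> verts G"
    using edges_subset_pairs by (auto simp: pairs_def)
  then have "p = {label G u, label G v}" "{vertex G (label G u), vertex G (label G v)} \<in> edges G"
    using e by (auto simp: vertex_label)
  then show "p \<in> label_edges G"
    using uv label_in_labels by (auto simp: label_edges_def)
qed

lemma edges_image: "edges G = (`) (vertex G) ` label_edges G"
proof -
  have "vertex G ` label G ` e = e" if "e \<in> edges G" for e
    using that edges_subset_pairs by (auto simp: pairs_def vertex_label)
  then show ?thesis by (simp add: label_edges_image image_image)
qed

text \<open>This allows \<open>vertex G\<close> to be cancelled in equations between edge
  sets.\<close>

lemma inj_on_vertex_image: "inj_on ((`) (vertex G)) (pairs (labels G))"
proof -
  have "inj_on ((`) (vertex G)) (Pow (labels G))"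
    using bij_betw_vertex by (simp add: bij_betw_def inj_on_image_Pow)
  then show ?thesis by (rule inj_on_subset) (auto simp: pairs_def)
qed

lemma permute_eq: "permute G \<sigma> = G\<lparr>edges := (`) (vertex G) ` pulled_edges G \<sigma>\<rparr>"
proof -
  have "i \<noteq> j" if "{\<sigma> i, \<sigma> j} \<in> label_edges G" for i j
    using that by (auto simp: label_edges_eq pairs_def doubleton_eq_iff)
  then have pulled: "pulled_edges G \<sigma> =
      {{i, j} | i j. i \<in> labels G \<and> j \<in> labels G \<and> {\<sigma> i, \<sigma> j} \<in> label_edges G}"
    by (fastforce simp: pulled_edges_def pairs_def)
  have "{{vertex G i, vertex G j} | i j. i \<in> labels G \<and> j \<in> labels G \<and> {\<sigma> i, \<sigma> j} \<in> label_edges G}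
      = (`) (vertex G) ` pulled_edges G \<sigma>" (is "?M = _")
  proof
    show "?M \<subseteq> (`) (vertex G) ` pulled_edges G \<sigma>"
    proof
      fix e assume "e \<in> ?M"
      then obtain i j where "{i, j} \<in> pulled_edges G \<sigma>" "e = vertex G ` {i, j}"
        unfolding pulled by auto
      then show "e \<in> (`) (vertex G) ` pulled_edges G \<sigma>" by blast
    qed
  qed (auto simp: pulled)
  then show ?thesis unfolding permute_def by (rule arg_cong)
qed

text \<open>Both records are \<open>G\<close> with new edges, so they agree iff their edge sets do;
  injectivity of \<open>vertex G\<close> on pairs moves this comparison to the labels.\<close>

lemma permute_eq_iff:
  assumes "M \<subseteq> pairs (labels G)"
  shows "permute G \<sigma> = G\<lparr>edges := (`) (vertex G) ` M\<rparr> \<longleftrightarrow> pulled_edges G \<sigma> = M"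
proof -
  have "permute G \<sigma> = G\<lparr>edges := (`) (vertex G) ` M\<rparr> \<longleftrightarrow>
      (`) (vertex G) ` pulled_edges G \<sigma> = (`) (vertex G) ` M"
    unfolding permute_eq by (metis ugraph.select_convs(2) ugraph.surjective ugraph.update_convs(2))
  also have "\<dots> \<longleftrightarrow> pulled_edges G \<sigma> = M"
    using inj_on_vertex_image assms
    by (intro inj_on_image_eq_iff) (auto simp: pulled_edges_def)
  finally show ?thesis .
qed

lemma permute_eq_self_iff: "permute G \<sigma> = G \<longleftrightarrow> pulled_edges G \<sigma> = label_edges G"
proof -
  have "G = G\<lparr>edges := (`) (vertex G) ` label_edges G\<rparr>"
    by (simp add: edges_image[symmetric])
  then show ?thesis
    using permute_eq_iff[OF label_edges_subset_pairs, of \<sigma>] by metis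
qed

lemma permute_eq_replace_edge_iff:
  assumes "e \<in> pairs (labels G)" "e' \<in> pairs (labels G)"
  shows "permute G \<sigma> = replace_edge G e e' \<longleftrightarrow> pulled_edges G \<sigma> = insert e' (label_edges G - {e})"
proof -
  have "edges G - {vertex G ` e} = (`) (vertex G) ` (label_edges G - {e})"
    using inj_on_image_set_diff[OF inj_on_vertex_image, of "label_edges G" "{e}"]
      label_edges_subset_pairs assms(1) by (auto simp: edges_image)
  then have "replace_edge G e e' = G\<lparr>edges := (`) (vertex G) ` insert e' (label_edges G - {e})\<rparr>"
    by (simp add: replace_edge_def)
  then show ?thesis
    using permute_eq_iff[of "insert e' (label_edges G - {e})" \<sigma>] assms label_edges_subset_pairs
    by auto
qed

lemma vertex_image_in_edges_iff:
  "p \<in> pairs (labels G) \<Longrightarrow> vertex G ` p \<in> edges G \<longleftrightarrow> p \<in> label_edges G"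
  by (simp add: label_edges_eq)

lemma vertex_image_pairs:
  assumes "p \<in> pairs (labels G)"
  shows "vertex G ` p \<in> pairs (verts G)"
proof -
  obtain i j where "p = {i, j}" "i \<in> labels G" "j \<in> labels G" "i \<noteq> j"
    using assms by (auto simp: pairs_def)
  moreover from this have "vertex G i \<noteq> vertex G j" by (metis label_vertex)
  ultimately show ?thesis using vertex_in_verts by (auto simp: pairs_def)
qed

lemma edge_replacement_iff:
  "edge_replacement G e e' \<longleftrightarrow>
    e \<in> label_edges G \<and> e' \<in> (pairs (labels G) - label_edges G) \<union> {e}"
proof -
  have "vertex G ` e' = vertex G ` e \<longleftrightarrow> e' = e"
    if "e \<in> pairs (labels G)" "e' \<in> pairs (labels G)"
    using that inj_on_vertex_image by (auto simp: inj_on_def)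
  then show ?thesis
    using label_edges_subset_pairs
    by (auto simp: edge_replacement_def vertex_image_in_edges_iff vertex_image_pairs)
qed

text \<open>The isomorphism sends the vertex labeled i to the vertex labeled
  \<open>\<sigma> i\<close>. Hence every replacement realized by a permutation is automatically
  feasible.\<close>

lemma isomorphic_permute:
  assumes "\<sigma> \<in> Bij (labels G)"
  shows "isomorphic (permute G \<sigma>) G"
proof -
  let ?f = "vertex G \<circ> \<sigma> \<circ> label G"
  have lab: "bij_betw (label G) (verts G) (labels G)" using lg by (simp add: labeled_graph_def)
  have \<sigma>: "\<sigma> i \<in> labels G" if "i \<in> labels G" for i
    using that assms Bij_imp_funcset by blast
  have "bij_betw ?f (verts G) (verts G)"
    by (rule bij_betw_trans[OF lab bij_betw_trans[OF Bij_bij_betw[OF assms] bij_betw_vertex],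
        unfolded comp_assoc[symmetric]])
  moreover have "{u, v} \<in> edges (permute G \<sigma>) \<longleftrightarrow> {?f u, ?f v} \<in> edges G"
    if uv: "u \<in> verts G" "v \<in> verts G" for u v
  \<comment> \<open>The definition of \<open>isomorphic\<close> also ranges over equal vertices;
    there both sides are false, since a singleton is never an edge.\<close>
  proof (cases "u = v")
    case True
    have "edges (permute G \<sigma>) \<subseteq> pairs (verts G)"
      using vertex_image_pairs by (auto simp: permute_eq pulled_edges_def)
    moreover have "{w} \<notin> pairs (verts G)" for w by (auto simp: pairs_def doubleton_eq_iff)
    ultimately show ?thesis using True edges_subset_pairs by auto
  next
    case False
    let ?p = "{label G u, label G v}"
    have ne: "label G u \<noteq> label G v" using uv False by (metis vertex_label)
    then have p: "?p \<in> pairs (labels G)" using uv label_in_labels by (auto simp: pairs_def)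
    have "\<sigma> (label G u) \<noteq> \<sigma> (label G v)"
      using ne assms uv label_in_labels by (metis Bij_bij_betw bij_betw_imp_inj_on inj_onD)
    then have sp: "\<sigma> ` ?p \<in> pairs (labels G)"
      using \<sigma> label_in_labels uv by (auto simp: pairs_def)
    have "{u, v} = vertex G ` ?p" using uv by (simp add: vertex_label)
    then have "{u, v} \<in> edges (permute G \<sigma>) \<longleftrightarrow> ?p \<in> pulled_edges G \<sigma>"
      using inj_on_vertex_image p
      by (simp add: permute_eq inj_on_image_mem_iff pulled_edges_def del: image_insert)
    also have "\<dots> \<longleftrightarrow> vertex G ` \<sigma> ` ?p \<in> edges G"
      using p sp by (simp add: pulled_edges_def vertex_image_in_edges_iff del: image_insert)
    finally show ?thesis by simp
  qed
  ultimately show ?thesis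
    unfolding isomorphic_def by (intro exI[of _ ?f]) (simp add: permute_eq)
qed

section \<open>Counting edges: the generators are the almost automorphisms\<close>

lemma image_pulled_edges:
  assumes \<sigma>: "\<sigma> \<in> Bij (labels G)"
  shows "(`) \<sigma> ` pulled_edges G \<sigma> = label_edges G"
proof (rule equalityI; rule subsetI)
  fix p assume "p \<in> (`) \<sigma> ` pulled_edges G \<sigma>"
  then show "p \<in> label_edges G" by (auto simp: pulled_edges_def)
next
  fix p assume p: "p \<in> label_edges G"
  then obtain i j where ij: "p = {i, j}" "i \<in> labels G" "j \<in> labels G" "i \<noteq> j"
    using label_edges_subset_pairs by (auto simp: pairs_def)
  obtain k l where kl: "k \<in> labels G" "l \<in> labels G" "i = \<sigma> k" "j = \<sigma> l"
    using ij Bij_bij_betw[OF \<sigma>] by (metis bij_betw_def image_iff)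
  then have "{k, l} \<in> pulled_edges G \<sigma>" "p = \<sigma> ` {k, l}"
    using ij p by (auto simp: pulled_edges_def pairs_def)
  then show "p \<in> (`) \<sigma> ` pulled_edges G \<sigma>" by blast
qed

lemma card_pulled_edges:
  assumes \<sigma>: "\<sigma> \<in> Bij (labels G)"
  shows "card (pulled_edges G \<sigma>) = card (label_edges G)"
proof -
  have "inj_on ((`) \<sigma>) (Pow (labels G))"
    using Bij_bij_betw[OF \<sigma>] by (simp add: bij_betw_def inj_on_image_Pow)
  then have "inj_on ((`) \<sigma>) (pulled_edges G \<sigma>)"
    by (rule inj_on_subset) (auto simp: pulled_edges_def pairs_def)
  then show ?thesis
    using image_pulled_edges[OF \<sigma>] by (metis card_image)
qed

text \<open>For an almost automorphism with exceptional edge \<open>f\<close>, the pulled-back edges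
  contain all edges except possibly \<open>f\<close> and are equally many. So either the two sets
  coincide and \<open>\<sigma>\<close> is an automorphism, or \<open>f\<close> is exchanged for
  exactly one other pair, which gives a feasible replacement.\<close>

lemma Fer_generators_eq: "Fer_generators G = almost_aut (label_edges G) (labels G)"
proof (rule equalityI; rule subsetI)
  fix \<sigma> assume "\<sigma> \<in> Fer_generators G"
  then obtain \<rho> where \<rho>: "\<rho> \<in> feasible_replacements G" "\<sigma> \<in> Fer_replacement G \<rho>"
    by (auto simp: Fer_generators_def)
  show "\<sigma> \<in> almost_aut (label_edges G) (labels G)"
  proof (cases \<rho>)
    case Neutral
    then have "\<sigma> \<in> Bij (labels G)" "pulled_edges G \<sigma> = label_edges G"
      using \<rho> by (auto simp: Aut_def carrier_BijGroup permute_eq_self_iff)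
    then show ?thesis by (auto simp: almost_aut_def pulled_edges_def)
  next
    case (Replace e e')
    then have ee: "e \<in> pairs (labels G)" "e' \<in> pairs (labels G)"
      using \<rho> by (auto simp: feasible_replacements_def feasible_def edge_replacement_def)
    then have "\<sigma> \<in> Bij (labels G)" "pulled_edges G \<sigma> = insert e' (label_edges G - {e})"
      using \<rho> Replace by (auto simp: carrier_BijGroup permute_eq_replace_edge_iff)
    moreover from this have "\<forall>p\<in>label_edges G - {e}. \<sigma> ` p \<in> label_edges G"
      by (auto simp: pulled_edges_def)
    ultimately show ?thesis by (auto simp: almost_aut_def)
  qed
next
  fix \<sigma> assume "\<sigma> \<in> almost_aut (label_edges G) (labels G)"
  then obtain f where \<sigma>: "\<sigma> \<in> Bij (labels G)"
    and f: "\<forall>p\<in>label_edges G - {f}. \<sigma> ` p \<in> label_edges G"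
    by (auto simp: almost_aut_def)
  let ?L = "label_edges G" and ?M = "pulled_edges G \<sigma>"
  have sub: "?L - {f} \<subseteq> ?M"
    using f label_edges_subset_pairs by (auto simp: pulled_edges_def)
  have fin: "finite ?M" "finite ?L"
    using finite_pairs[OF finite_labels] label_edges_subset_pairs
    by (auto simp: pulled_edges_def intro: finite_subset)
  have "\<exists>\<rho>\<in>feasible_replacements G. \<sigma> \<in> Fer_replacement G \<rho>"
  proof (cases "?L \<subseteq> ?M")
    case True
    then have "?M = ?L"
      using card_pulled_edges[OF \<sigma>] fin by (metis card_subset_eq)
    then have "\<sigma> \<in> Fer_replacement G Neutral"
      using \<sigma> by (simp add: Aut_def carrier_BijGroup permute_eq_self_iff)
    then show ?thesis by (auto simp: feasible_replacements_def)
  next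
    case False
    then have fL: "f \<in> ?L" "f \<notin> ?M" using sub by auto
    then have "card (?L - {f}) = card ?L - 1" "card ?L > 0"
      using fin card_gt_0_iff by auto
    then have "card (?M - (?L - {f})) = 1"
      using card_pulled_edges[OF \<sigma>] card_Diff_subset[OF _ sub] fin by simp
    then obtain e' where e': "?M - (?L - {f}) = {e'}" by (auto simp: card_1_singleton_iff)
    then have M: "?M = insert e' (?L - {f})" using sub by blast
    \<comment> \<open>The new pair is pulled back while \<open>f\<close> is not, so they differ;
      hence the replacement is not trivial and \<open>e'\<close> is a non-edge.\<close>
    have e'P: "e' \<in> pairs (labels G) - ?L" "e' \<noteq> f"
      using e' fL by (auto simp: pulled_edges_def)
    have perm: "permute G \<sigma> = replace_edge G f e'"
      using permute_eq_replace_edge_iff[of f e' \<sigma>] fL e'P M label_edges_subset_pairs by auto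
    then have "feasible G f e'"
      using isomorphic_permute[OF \<sigma>] fL e'P by (simp add: feasible_def edge_replacement_iff)
    then have "Replace f e' \<in> feasible_replacements G"
      using e'P by (auto simp: feasible_replacements_def)
    moreover have "\<sigma> \<in> Fer_replacement G (Replace f e')"
      using \<sigma> perm by (simp add: carrier_BijGroup)
    ultimately show ?thesis by blast
  qed
  then show "\<sigma> \<in> Fer_generators G" by (auto simp: Fer_generators_def)
qed

lemma Fer_eq: "Fer G = generate (BijGroup (labels G)) (almost_aut (label_edges G) (labels G))"
  by (simp add: Fer_def Fer_generators_eq)

end

section \<open>Adding isolated labels\<close>

text \<open>Here b is isolated and a lies in no edge other than possibly \<open>f\<close>, so the
  transposition fixes every other edge pointwise.\<close>

lemma transpose_almost_aut:
  assumes "E \<subseteq> Pow A" "a \<in> A" "b \<in> A" "\<And>e. e \<in> E \<Longrightarrow> b \<notin> e"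
    and "\<And>e. e \<in> E - {f} \<Longrightarrow> a \<notin> e"
  shows "restrict (transpose a b) A \<in> almost_aut E A"
proof -
  have "restrict (transpose a b) A ` e = e" if "e \<in> E - {f}" for e
  proof -
    have "restrict (transpose a b) A x = x" if "x \<in> e" for x
      using that \<open>e \<in> E - {f}\<close> assms by (auto simp: transpose_def)
    then show ?thesis by simp
  qed
  then show ?thesis
    by (intro almost_autI[OF transpose_Bij[OF assms(2,3)], of _ f]) (simp)
qed

text \<open>Where \<open>\<sigma>\<close> stays inside the image of \<open>A\<close>, it induces a
  partial injection of \<open>A\<close>, which is completed arbitrarily to a bijection. An edge that
  \<open>\<sigma>\<close> maps to an edge lies wholly in the domain of this injection, so the
  arbitrary part does not affect it.\<close>

lemma almost_aut_transfer:
  assumes "finite A" "E \<subseteq> Pow A" "inj_on g A" "g ` A \<subseteq> B"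
    and \<sigma>: "\<sigma> \<in> almost_aut ((`) g ` E) B"
  obtains \<tau> where "\<tau> \<in> almost_aut E A" "\<And>x. x \<in> A \<Longrightarrow> \<sigma> (g x) \<in> g ` A \<Longrightarrow> g (\<tau> x) = \<sigma> (g x)"
proof -
  from \<sigma> obtain f where \<sigma>B: "\<sigma> \<in> Bij B"
    and f: "\<And>e. e \<in> (`) g ` E \<Longrightarrow> e \<noteq> f \<Longrightarrow> \<sigma> ` e \<in> (`) g ` E"
    by (rule almost_autE) blast
  define K where "K = {x \<in> A. \<sigma> (g x) \<in> g ` A}"
  define h where "h x = inv_into A g (\<sigma> (g x))" for x
  have gh: "g (h x) = \<sigma> (g x)" "h x \<in> A" if "x \<in> K" for x
    using that by (auto simp: K_def h_def f_inv_into_f intro: inv_into_into)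
  have KA: "K \<subseteq> A" "h ` K \<subseteq> A" using gh(2) by (auto simp: K_def)
  have "inj_on h K"
  proof (rule inj_onI)
    fix x y assume "x \<in> K" "y \<in> K" "h x = h y"
    then have "\<sigma> (g x) = \<sigma> (g y)" using gh by metis
    moreover have xy: "x \<in> A" "y \<in> A" using \<open>x \<in> K\<close> \<open>y \<in> K\<close> by (auto simp: K_def)
    moreover have "g x \<in> B" "g y \<in> B" using xy assms(4) by auto
    ultimately have "g x = g y"
      using bij_betw_imp_inj_on[OF Bij_bij_betw[OF \<sigma>B]] by (metis inj_onD)
    then show "x = y" using xy assms(3) by (metis inj_onD)
  qed
  then obtain \<tau> where \<tau>: "\<tau> \<in> Bij A" "\<And>x. x \<in> K \<Longrightarrow> \<tau> x = h x"
    using inj_on_extend_Bij[OF \<open>finite A\<close> KA(1) _ KA(2)] by blast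
  have "\<tau> ` e \<in> E" if "e \<in> E" "g ` e \<noteq> f" for e
  proof -
    have "\<sigma> ` g ` e \<in> (`) g ` E" using that by (intro f imageI)
    then obtain e2 where e2: "e2 \<in> E" "\<sigma> ` g ` e = g ` e2" by (rule imageE)
    then have "\<sigma> (g x) \<in> g ` A" if "x \<in> e" for x
      using that assms(2) by (metis PowD image_eqI image_mono subsetD)
    then have eK: "e \<subseteq> K" using \<open>e \<in> E\<close> assms(2) by (auto simp: K_def)
    then have "g ` \<tau> ` e = g ` e2"
      using gh \<tau> e2 by (auto simp: image_image subset_iff cong: image_cong)
    moreover have "\<tau> ` e \<subseteq> A" "e2 \<subseteq> A" using eK gh \<tau> e2 assms(2) by auto
    ultimately have "\<tau> ` e = e2" using assms(3) by (metis inj_on_image_eq_iff)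
    then show ?thesis using e2 by simp
  qed
  \<comment> \<open>The exceptional set \<open>f\<close> need not come from an edge in
    \<open>E\<close>; if it does, this is the only edge it can come from.\<close>
  moreover have "e = inv_into A g ` f" if "e \<in> E" "g ` e = f" for e
    using that assms(2,3) by (metis PowD inv_into_image_cancel subsetD)
  ultimately have "\<tau> \<in> almost_aut E A"
    by (intro almost_autI[OF \<tau>(1), of _ "inv_into A g ` f"]) metis
  then show thesis
    by (rule that) (use \<tau> gh K_def in auto)
qed

text \<open>Transport along \<open>g\<close> and extend by the identity: all edges of the larger
  graph lie in the image of \<open>A\<close>, so the added labels create no further exceptional
  edge.\<close>

lemma almost_aut_extend:
  assumes "E \<subseteq> Pow A" "inj_on g A" "g ` A \<subseteq> B" and \<sigma>: "\<sigma> \<in> almost_aut E A"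
  obtains \<tau> where "\<tau> \<in> almost_aut ((`) g ` E) B" "\<And>x. x \<in> A \<Longrightarrow> \<tau> (g x) = g (\<sigma> x)"
    "\<And>y. y \<in> B - g ` A \<Longrightarrow> \<tau> y = y"
proof -
  from \<sigma> obtain f where \<sigma>A: "\<sigma> \<in> Bij A" and f: "\<And>e. e \<in> E \<Longrightarrow> e \<noteq> f \<Longrightarrow> \<sigma> ` e \<in> E"
    by (rule almost_autE) blast
  define \<tau> where "\<tau> = (\<lambda>y\<in>B. if y \<in> g ` A then (g \<circ> \<sigma> \<circ> inv_into A g) y else id y)"
  have g: "bij_betw g A (g ` A)" using assms(2) by (simp add: bij_betw_def)
  have "bij_betw (g \<circ> \<sigma> \<circ> inv_into A g) (g ` A) (g ` A)"
    by (rule bij_betw_trans[OF bij_betw_inv_into[OF g] bij_betw_trans[OF Bij_bij_betw[OF \<sigma>A] g],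
        unfolded comp_assoc[symmetric]])
  then have "bij_betw (\<lambda>y. if y \<in> g ` A then (g \<circ> \<sigma> \<circ> inv_into A g) y else id y)
      (g ` A \<union> (B - g ` A)) (g ` A \<union> (B - g ` A))"
    by (rule bij_betw_disjoint_Un) (auto simp: bij_betw_def)
  moreover have "g ` A \<union> (B - g ` A) = B" using assms(3) by auto
  ultimately have \<tau>B: "\<tau> \<in> Bij B"
    by (simp add: \<tau>_def restrict_bij_betw_Bij)
  have \<tau>g: "\<tau> (g x) = g (\<sigma> x)" if "x \<in> A" for x
    using that assms(2,3) by (auto simp: \<tau>_def)
  have "\<tau> ` g ` e \<in> (`) g ` E" if "e \<in> E" "g ` e \<noteq> g ` f" for e
  proof -
    have "\<tau> ` g ` e = g ` \<sigma> ` e"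
      using that assms(1) \<tau>g by (auto simp: image_image subset_iff intro!: image_cong)
    moreover have "\<sigma> ` e \<in> E" using that by (intro f) auto
    ultimately show ?thesis by simp
  qed
  then have "\<tau> \<in> almost_aut ((`) g ` E) B"
    by (intro almost_autI[OF \<tau>B, of _ "g ` f"]) (erule imageE, simp)
  then show thesis
    by (rule that) (use \<tau>g in \<open>auto simp: \<tau>_def\<close>)
qed

text \<open>A label outside the orbit of the isolated label \<open>z\<close> lies in two edges, since otherwise it could
  be swapped with \<open>z\<close>. So an almost automorphism of the larger graph maps one of these edges to an
  edge, hence the label back into \<open>A\<close>, and the complement of the orbit stays invariant.\<close>

lemma orbit_isolated_eq_if_generate_eq_Bij:
  assumes "finite A" "E \<subseteq> Pow A" "inj_on g A" "g ` A \<subseteq> B" "z \<in> A" "\<And>e. e \<in> E \<Longrightarrow> z \<notin> e"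
    and full: "generate (BijGroup B) (almost_aut ((`) g ` E) B) = Bij B" and "x \<in> A"
  shows "\<exists>\<sigma>\<in>generate (BijGroup A) (almost_aut E A). \<sigma> z = x"
proof (rule ccontr)
  let ?F = "generate (BijGroup A) (almost_aut E A)"
  assume contra: "\<not> ?thesis"
  interpret F: subgroup ?F "BijGroup A" by (rule subgroup_generate_almost_aut)
  have FA: "?F \<subseteq> Bij A" using F.subset by (simp add: carrier_BijGroup)
  define C where "C = {y \<in> A. \<forall>\<sigma>\<in>?F. \<sigma> z \<noteq> y}"
  \<comment> \<open>Leaving \<open>f\<close> arbitrary expresses membership in at least two edges:
    whichever edge is discarded, another one through \<open>y\<close> remains.\<close>
  have two: "\<exists>e\<in>E - {f}. y \<in> e" if "y \<in> C" for y f
  proof (rule ccontr)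
    assume "\<not> ?thesis"
    then have "restrict (transpose y z) A \<in> almost_aut E A"
      using that assms(2,5,6) by (intro transpose_almost_aut[where f = f]) (auto simp: C_def)
    then have "restrict (transpose y z) A \<in> ?F" by (rule generate.incl)
    moreover have "restrict (transpose y z) A z = y" using \<open>z \<in> A\<close> by simp
    ultimately show False using that by (auto simp: C_def)
  qed
  \<comment> \<open>If \<open>\<tau> y\<close> were in the orbit of \<open>z\<close>, applying the
    inverse of \<open>\<tau>\<close> would put \<open>y\<close> there too.\<close>
  have Cinv: "\<tau> y \<in> C" if "\<tau> \<in> ?F" "y \<in> C" for \<tau> y
  proof -
    have y: "y \<in> A" using that by (simp add: C_def)
    have \<tau>: "\<tau> \<in> Bij A" using that FA by auto
    have "\<sigma> z \<noteq> \<tau> y" if "\<sigma> \<in> ?F" for \<sigma>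
    proof
      assume eq: "\<sigma> z = \<tau> y"
      have inv: "inv\<^bsub>BijGroup A\<^esub> \<tau> \<in> ?F" using \<open>\<tau> \<in> ?F\<close> by (rule F.m_inv_closed)
      then have m: "inv\<^bsub>BijGroup A\<^esub> \<tau> \<otimes>\<^bsub>BijGroup A\<^esub> \<sigma> \<in> ?F" using \<open>\<sigma> \<in> ?F\<close> by (rule F.m_closed)
      have "inv\<^bsub>BijGroup A\<^esub> \<tau> \<otimes>\<^bsub>BijGroup A\<^esub> \<sigma> = compose A (inv\<^bsub>BijGroup A\<^esub> \<tau>) \<sigma>"
        using inv \<open>\<sigma> \<in> ?F\<close> FA by (intro mult_BijGroup) auto
      then have "(inv\<^bsub>BijGroup A\<^esub> \<tau> \<otimes>\<^bsub>BijGroup A\<^esub> \<sigma>) z = (inv\<^bsub>BijGroup A\<^esub> \<tau>) (\<tau> y)"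
        using \<open>z \<in> A\<close> eq by (simp add: compose_def)
      also have "\<dots> = y"
        using y Bij_bij_betw[OF \<tau>] by (auto simp: inv_BijGroup[OF \<tau>] bij_betw_def)
      finally show False using m \<open>y \<in> C\<close> by (auto simp: C_def)
    qed
    moreover have "\<tau> y \<in> A" using \<tau> y Bij_imp_funcset by blast
    ultimately show ?thesis by (simp add: C_def)
  qed
  have "\<sigma> ` g ` C \<subseteq> g ` C" if \<sigma>: "\<sigma> \<in> almost_aut ((`) g ` E) B" for \<sigma>
  proof -
    obtain \<tau> where \<tau>: "\<tau> \<in> almost_aut E A" "\<And>x. x \<in> A \<Longrightarrow> \<sigma> (g x) \<in> g ` A \<Longrightarrow> g (\<tau> x) = \<sigma> (g x)"
      using almost_aut_transfer[OF assms(1-4) \<sigma>] by blast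
    obtain f where f: "\<And>e. e \<in> (`) g ` E \<Longrightarrow> e \<noteq> f \<Longrightarrow> \<sigma> ` e \<in> (`) g ` E"
      using \<sigma> by (rule almost_autE) blast
    have "\<sigma> (g y) \<in> g ` C" if y: "y \<in> C" for y
    proof -
      \<comment> \<open>An edge through \<open>y\<close> is chosen so as to avoid the only edge
        whose image can be the exceptional set \<open>f\<close>.\<close>
      obtain e where e: "e \<in> E" "y \<in> e" "e \<noteq> inv_into A g ` f" using two[OF y, of "inv_into A g ` f"] by blast
      have "g ` e \<noteq> f"
        using e assms(2,3) by (metis PowD inv_into_image_cancel subsetD)
      then have "\<sigma> ` g ` e \<in> (`) g ` E" using e by (intro f imageI)
      then have "\<sigma> ` g ` e \<subseteq> g ` A" using assms(2) by (metis PowD image_iff image_mono subsetD)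
      then have "\<sigma> (g y) \<in> g ` A" using e(2) by blast
      then have "g (\<tau> y) = \<sigma> (g y)" using \<tau>(2) y by (simp add: C_def)
      moreover have "\<tau> y \<in> C" using Cinv[OF generate.incl[OF \<tau>(1)] y] .
      ultimately show ?thesis by (metis imageI)
    qed
    then show ?thesis by blast
  qed
  moreover have "finite (g ` C)" "g ` C \<subseteq> B"
    using assms(1,4) by (auto simp: C_def)
  ultimately have inv: "\<sigma> ` g ` C \<subseteq> g ` C" if "\<sigma> \<in> Bij B" for \<sigma>
    using generate_image_subset[OF _ almost_aut_subset_Bij, of \<sigma> B "(`) g ` E" "g ` C"] that full
    by blast
  have "x \<in> C" using contra \<open>x \<in> A\<close> by (auto simp: C_def)
  have gB: "g x \<in> B" "g z \<in> B" using assms(4,5,8) by auto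
  \<comment> \<open>The full symmetric group contains the swap of \<open>g x\<close> and
    \<open>g z\<close>; invariance would then place \<open>z\<close> outside its own orbit.\<close>
  have "restrict (transpose (g x) (g z)) B (g x) \<in> g ` C"
    using inv[OF transpose_Bij[OF gB]] \<open>x \<in> C\<close> by blast
  then have "g z \<in> g ` C" using gB by simp
  then have "z \<in> C" using assms(3,5) by (auto simp: C_def inj_on_eq_iff)
  moreover have "\<one>\<^bsub>BijGroup A\<^esub> \<in> ?F" by (rule F.one_closed)
  moreover have "\<one>\<^bsub>BijGroup A\<^esub> z = z" using \<open>z \<in> A\<close> by (simp add: one_BijGroup)
  ultimately show False by (auto simp: C_def)
qed

text \<open>Let \<open>D\<close> be the set of labels whose images can be swapped with the new label
  \<open>w\<close>. It contains \<open>z\<close>, since \<open>z\<close> and \<open>w\<close> are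
  both isolated. Almost automorphisms of the smaller graph extend to ones fixing \<open>w\<close>,
  and conjugation by these keeps \<open>D\<close> invariant. So \<open>D\<close> contains the orbit
  of \<open>z\<close>, which is all of \<open>A\<close>, and a full star of transpositions at
  \<open>w\<close> is available.\<close>

lemma generate_eq_Bij_if_orbit_isolated_eq:
  assumes "finite A" "E \<subseteq> Pow A" "inj_on g A" "w \<notin> g ` A" "z \<in> A" "\<And>e. e \<in> E \<Longrightarrow> z \<notin> e"
    and trans: "\<And>x. x \<in> A \<Longrightarrow> \<exists>\<sigma>\<in>generate (BijGroup A) (almost_aut E A). \<sigma> z = x"
    and B: "B = insert w (g ` A)"
  shows "generate (BijGroup B) (almost_aut ((`) g ` E) B) = Bij B"
proof -
  let ?F = "generate (BijGroup B) (almost_aut ((`) g ` E) B)"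
  have F: "subgroup ?F (BijGroup B)" by (rule subgroup_generate_almost_aut)
  define D where "D = {x \<in> A. restrict (transpose (g x) w) B \<in> ?F}"
  have "restrict (transpose (g z) w) B \<in> almost_aut ((`) g ` E) B"
    using assms(2-6) B by (intro transpose_almost_aut) (auto simp: subset_iff inj_on_eq_iff)
  then have z: "z \<in> D" using \<open>z \<in> A\<close> by (auto simp: D_def intro: generate.incl)
  have "\<sigma> ` D \<subseteq> D" if \<sigma>: "\<sigma> \<in> almost_aut E A" for \<sigma>
  proof -
    obtain \<tau> where \<tau>: "\<tau> \<in> almost_aut ((`) g ` E) B" "\<And>x. x \<in> A \<Longrightarrow> \<tau> (g x) = g (\<sigma> x)"
      "\<And>y. y \<in> B - g ` A \<Longrightarrow> \<tau> y = y"
      using almost_aut_extend[OF assms(2,3) _ \<sigma>, of B] B by blast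
    have "\<sigma> x \<in> D" if x: "x \<in> D" for x
    proof -
      have xA: "x \<in> A" and t: "restrict (transpose (g x) w) B \<in> ?F" using x by (auto simp: D_def)
      have "restrict (transpose (\<tau> (g x)) (\<tau> w)) B \<in> ?F"
        by (rule subgroup_conj_transpose[OF F generate.incl[OF \<tau>(1)] t]) (use xA B in auto)
      then have "restrict (transpose (g (\<sigma> x)) w) B \<in> ?F"
        using \<tau>(2)[OF xA] \<tau>(3)[of w] B assms(4) by simp
      moreover have "\<sigma> x \<in> A" using \<sigma> almost_aut_subset_Bij Bij_imp_funcset xA by blast
      ultimately show ?thesis by (simp add: D_def)
    qed
    then show ?thesis by blast
  qed
  then have "\<sigma> ` D \<subseteq> D" if "\<sigma> \<in> generate (BijGroup A) (almost_aut E A)" for \<sigma>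
    using that \<open>finite A\<close> by (intro generate_image_subset[OF that almost_aut_subset_Bij]) (auto simp: D_def)
  then have "x \<in> D" if "x \<in> A" for x using trans[OF that] z by blast
  then have "restrict (transpose a w) B \<in> ?F" if "a \<in> B" "a \<noteq> w" for a
    using that B by (auto simp: D_def)
  then show ?thesis
    using B \<open>finite A\<close> by (intro subgroup_star_transpositions[OF F, of w]) auto
qed

section \<open>The equivalence for a graph with one added isolated vertex\<close>

lemma underlying_eq_add_isolated_iff:
  "underlying H = add_isolated G t \<longleftrightarrow>
    verts H = verts G <+> {..<t} \<and> edges H = (`) Inl ` edges G"
  by (simp add: underlying_def add_isolated_def ugraph.truncate_def)

theorem corollary2:
  fixes G :: "'v ugraph" and Gstar :: "('v + nat, 'x) lgraph"
  assumes "simple_graph G"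
    and "labeled_graph Gstar"
    and "underlying Gstar = add_isolated G 1"
  shows "global_amoeba G \<longleftrightarrow>
    transitive_action (Fer_group Gstar) (labels Gstar) (\<lambda>\<sigma>. \<sigma>)"
proof -
  let ?A = "labels Gstar" and ?E = "label_edges Gstar"
  let ?F = "generate (BijGroup ?A) (almost_aut ?E ?A)"
  define z where "z = label Gstar (Inr 0)"
  have verts: "verts Gstar = verts G <+> {..<1}" and edges: "edges Gstar = (`) Inl ` edges G"
    using assms(3) by (simp_all add: underlying_eq_add_isolated_iff)
  note lg = \<open>labeled_graph Gstar\<close>
  have fin: "finite ?A" using lg by (rule finite_labels)
  have E: "?E \<subseteq> Pow ?A" using label_edges_subset_pairs[OF lg] by (auto simp: pairs_def)
  have z: "z \<in> ?A" unfolding z_def by (rule label_in_labels[OF lg]) (auto simp: verts)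
  have zE: "z \<notin> e" if "e \<in> ?E" for e
  proof
    assume "z \<in> e"
    then have "vertex Gstar z \<in> vertex Gstar ` e" by blast
    moreover have "vertex Gstar ` e \<in> edges Gstar" using that edges_image[OF lg] by blast
    moreover have "vertex Gstar z = Inr 0"
      unfolding z_def by (rule vertex_label[OF lg]) (auto simp: verts)
    ultimately show False by (auto simp: edges)
  qed
  have transitive_iff: "transitive_action (Fer_group Gstar) ?A (\<lambda>\<sigma>. \<sigma>) \<longleftrightarrow>
      (\<forall>x\<in>?A. \<forall>y\<in>?A. \<exists>\<sigma>\<in>?F. \<sigma> x = y)"
    unfolding Fer_group_def Fer_eq[OF lg]
    by (rule transitive_action_subgroup_BijGroup[OF subgroup_generate_almost_aut])
  \<comment> \<open>Labels of \<open>Gstar\<close> pass to labels of \<open>H\<close> through the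
    shared vertices: with t at least 1, \<open>H\<close> contains all vertices of
    \<open>Gstar\<close>, and the edges are the same.\<close>
  have embed: "inj_on (label H \<circ> vertex Gstar) ?A"
    "(label H \<circ> vertex Gstar) ` ?A = label H ` verts Gstar"
    "label_edges H = (`) (label H \<circ> vertex Gstar) ` ?E"
    if H: "labeled_graph H" "underlying H = add_isolated G t" "t \<ge> 1"
    for H :: "('v + nat, nat) lgraph" and t
  proof -
    have vH: "verts H = verts G <+> {..<t}" and eH: "edges H = edges Gstar"
      using H edges by (simp_all add: underlying_eq_add_isolated_iff)
    have im: "vertex Gstar ` ?A = verts Gstar" and inj: "inj_on (vertex Gstar) ?A"
      using bij_betw_vertex[OF lg] by (auto simp: bij_betw_def)
    have "verts Gstar \<subseteq> verts H" using \<open>t \<ge> 1\<close> by (auto simp: verts vH)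
    moreover have "inj_on (label H) (verts H)" using H by (simp add: labeled_graph_def bij_betw_def)
    ultimately have "inj_on (label H) (vertex Gstar ` ?A)" unfolding im by (metis inj_on_subset)
    then show "inj_on (label H \<circ> vertex Gstar) ?A" using inj by (intro comp_inj_on)
    show "(label H \<circ> vertex Gstar) ` ?A = label H ` verts Gstar" by (metis im image_comp)
    show "label_edges H = (`) (label H \<circ> vertex Gstar) ` ?E"
      by (simp add: label_edges_image[OF H(1)] eH edges_image[OF lg] image_image)
  qed
  have labels: "label H ` verts H = labels H" if "labeled_graph H" for H :: "('v + nat, nat) lgraph"
    using that by (simp add: labeled_graph_def bij_betw_def)
  show ?thesis
  proof
    assume "global_amoeba G"
    then obtain t and H :: "('v + nat, nat) lgraph" where H: "labeled_graph H"
      "underlying H = add_isolated G t" "t \<ge> 1" and "local_amoeba H"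
      by (auto simp: global_amoeba_def)
    let ?g = "label H \<circ> vertex Gstar"
    have full: "generate (BijGroup (labels H)) (almost_aut ((`) ?g ` ?E) (labels H)) = Bij (labels H)"
      using \<open>local_amoeba H\<close> unfolding local_amoeba_def Fer_eq[OF H(1)] embed(3)[OF H] carrier_BijGroup .
    have "verts Gstar \<subseteq> verts H" using H verts by (auto simp: underlying_eq_add_isolated_iff)
    then have "?g ` ?A \<subseteq> labels H" using embed(2)[OF H] labels[OF H(1)] by blast
    then have orbit: "\<exists>\<sigma>\<in>?F. \<sigma> z = x" if "x \<in> ?A" for x
      using orbit_isolated_eq_if_generate_eq_Bij[OF fin E embed(1)[OF H] _ z zE full that] by blast
    interpret F: subgroup ?F "BijGroup ?A" by (rule subgroup_generate_almost_aut)
    \<comment> \<open>To move \<open>x\<close> to \<open>y\<close>, go back from \<open>x\<close> to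
      \<open>z\<close> and then from \<open>z\<close> to \<open>y\<close>.\<close>
    have "\<exists>\<sigma>\<in>?F. \<sigma> x = y" if xy: "x \<in> ?A" "y \<in> ?A" for x y
    proof -
      obtain \<sigma> \<tau> where \<sigma>: "\<sigma> \<in> ?F" "\<sigma> z = x" and \<tau>: "\<tau> \<in> ?F" "\<tau> z = y"
        using orbit xy by metis
      have \<sigma>A: "\<sigma> \<in> Bij ?A" and "\<tau> \<in> Bij ?A" "inv\<^bsub>BijGroup ?A\<^esub> \<sigma> \<in> Bij ?A"
        using F.subset \<sigma> \<tau> F.m_inv_closed[OF \<sigma>(1)] by (auto simp: carrier_BijGroup)
      then have "\<tau> \<otimes>\<^bsub>BijGroup ?A\<^esub> inv\<^bsub>BijGroup ?A\<^esub> \<sigma> = compose ?A \<tau> (inv\<^bsub>BijGroup ?A\<^esub> \<sigma>)"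
        by (intro mult_BijGroup)
      moreover have "(inv\<^bsub>BijGroup ?A\<^esub> \<sigma>) x = z"
        using \<sigma> xy z Bij_bij_betw[OF \<sigma>A] by (auto simp: inv_BijGroup[OF \<sigma>A] bij_betw_def)
      ultimately have "(\<tau> \<otimes>\<^bsub>BijGroup ?A\<^esub> inv\<^bsub>BijGroup ?A\<^esub> \<sigma>) x = y"
        using \<tau> xy by (simp add: compose_def)
      then show ?thesis using F.m_closed[OF \<tau>(1) F.m_inv_closed[OF \<sigma>(1)]] by blast
    qed
    then show "transitive_action (Fer_group Gstar) ?A (\<lambda>\<sigma>. \<sigma>)" using transitive_iff by blast
  next
    assume "transitive_action (Fer_group Gstar) ?A (\<lambda>\<sigma>. \<sigma>)"
    then have orbit: "\<exists>\<sigma>\<in>?F. \<sigma> z = x" if "x \<in> ?A" for x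
      using transitive_iff z that by blast
    \<comment> \<open>The witness is t = 2: \<open>Inr 0\<close> is the isolated vertex of
      \<open>Gstar\<close>, and \<open>Inr 1\<close> supplies the extra label
      \<open>w\<close>.\<close>
    let ?V = "verts G <+> {..<2::nat}"
    have "finite ?V" using \<open>simple_graph G\<close> by (simp add: simple_graph_def)
    then obtain l :: "'v + nat \<Rightarrow> nat" where l: "inj_on l ?V"
      \<comment> \<open>The definition of \<open>global_amoeba\<close> asks for labels in the
        natural numbers, whatever the label type of \<open>Gstar\<close>.\<close>
      using finite_imp_inj_to_nat_seg by metis
    define H where "H = \<lparr>verts = ?V, edges = (`) Inl ` edges G, labels = l ` ?V, label = l\<rparr>"
    have "Inl ` e \<in> pairs ?V" if "e \<in> edges G" for e
      using that \<open>simple_graph G\<close> by (fastforce simp: simple_graph_def pairs_def)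
    then have H: "labeled_graph H" "underlying H = add_isolated G 2" "(2::nat) \<ge> 1"
      using l \<open>finite ?V\<close>
      by (auto simp: labeled_graph_def simple_graph_def H_def bij_betw_def underlying_eq_add_isolated_iff)
    let ?g = "label H \<circ> vertex Gstar"
    have V: "?V = insert (Inr 1) (verts Gstar)" by (auto simp: verts)
    have "labels H = insert (l (Inr 1)) (?g ` ?A)"
      unfolding embed(2)[OF H] by (simp add: H_def V)
    moreover have "l (Inr 1) \<notin> ?g ` ?A"
      unfolding embed(2)[OF H] using l unfolding V by (auto simp: H_def verts)
    ultimately have "generate (BijGroup (labels H)) (almost_aut ((`) ?g ` ?E) (labels H)) = Bij (labels H)"
      using generate_eq_Bij_if_orbit_isolated_eq[OF fin E embed(1)[OF H] _ z zE orbit] by blast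
    then have "local_amoeba H"
      unfolding local_amoeba_def Fer_eq[OF H(1)] embed(3)[OF H] carrier_BijGroup .
    then show "global_amoeba G" using H unfolding global_amoeba_def by blast
  qed
qed

end
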